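(* Let $d\geq 3$, $i\geq 0$, $j\geq 1$, $I=[i,i+d-1]$ and $J=\{0\}\sqcup[j,j+d-3]$, and suppose $J\leq I\setminus\{i+d-1\}$. Set \[ \lambda=\frac{\prod_{k=1}^{d-1}b_{i+k-1,\,j-1}}{\prod_{k=0}^{d-3}b_{j+k-1,\,j-1}}. \] (a) If $2\leq r\leq d-1$, then \[ b^{I\setminus\{i+r-1\}}_J=\lambda\left(\frac{b_{d-2,r-1}}{b_{i+r-1,j-1}}+\frac{b_{d-2,r-2}}{b_{i+r-2,j-1}}\right). \] (b) If $r=1$ or $r=d$, then \[ b^{I\setminus\{i\}}_J=\frac{\lambda}{b_{i,j-1}}\quad\text{and}\quad b^{I\setminus\{i+d-1\}}_J=\frac{\lambda}{b_{i+d-2,j-1}}. \]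
   Context: For integers $p,q\geq 0$, $b_{p,q}=\binom{p}{q}$, with $b_{p,q}=0$ if $q>p$. For $k\leq l$, $[k,l]=\{k,\ldots,l\}$. For finite sets $I=\{i_1<\cdots<i_m\}$, $J=\{j_1<\cdots<j_m\}$ of non-negative integers, $b^I_J$ is the determinant of the $m\times m$ matrix with $(r,s)$ entry $b_{i_r,j_s}$, and $J\leq I$ means $j_k\leq i_k$ for all $k$. *)

theory Defs
  imports "Jordan_Normal_Form.Determinant"
begin

text \<open>
  For finite sets \<open>I\<close>, \<open>J\<close> of natural numbers of the same cardinality,
  \<open>binomial_minor I J\<close> is the determinant whose \<open>(r, s)\<close> entry is \<open>i\<^sub>r choose j\<^sub>s\<close>, where
  \<open>i\<^sub>r\<close> and \<open>j\<^sub>s\<close> list the elements of \<open>I\<close> and \<open>J\<close> in increasing order. The indices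
  \<open>r\<close>, \<open>s\<close> start at 0. The value is meaningless if the cardinalities differ.
\<close>

definition binomial_minor :: "nat set \<Rightarrow> nat set \<Rightarrow> int" where
  "binomial_minor I J =
     det (mat (card I) (card I)
       (\<lambda>(r, s). int ((sorted_list_of_set I ! r) choose (sorted_list_of_set J ! s))))"

definition index_le :: "nat set \<Rightarrow> nat set \<Rightarrow> bool" where
  "index_le J I \<longleftrightarrow> finite I \<and> finite J \<and> card J = card I \<and>
     (\<forall>k<card J. sorted_list_of_set J ! k \<le> sorted_list_of_set I ! k)"

end

theory Submission
  imports Defs
begin

text \<open>The first column of the minor is constantly 1, so subtracting consecutive rows removes it and,
  by Pascal's rule, lowers the other column indices by one. The gap at the deleted row produces a
  row that is the sum of two consecutive binomial rows, so the minor splits into two minors with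
  columns \<open>[j - 1, j + d - 4]\<close>. With \<open>m = j - 1\<close>, the identity
  \<open>b\<^bsub>x,m+s\<^esub> b\<^bsub>m+s,m\<^esub> = b\<^bsub>x,m\<^esub> b\<^bsub>x-m,s\<^esub>\<close> lets one pull row and column factors out of
  these until the columns are \<open>[0, d - 3]\<close>; such a minor is again of the first kind, and the
  splitting is then the Pascal recursion for \<open>b\<^bsub>d-2,t\<^esub>\<close>, where \<open>t\<close> is the position of the
  deleted row.\<close>

section \<open>Row operations and multilinearity of determinants\<close>

text \<open>Left multiplication by a unit lower bidiagonal matrix subtracts from each later row its
  predecessor and preserves the determinant. The first column becomes (1, 0, ..., 0), and expanding
  along it leaves the minor of differences.\<close>

lemma det_row_differences:
  fixes a :: "nat \<Rightarrow> nat \<Rightarrow> 'a :: comm_ring_1"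
  assumes one: "\<And>r. r \<le> n \<Longrightarrow> a r 0 = 1"
  shows "det (mat (Suc n) (Suc n) (\<lambda>(r, s). a r s)) =
         det (mat n n (\<lambda>(r, s). a (Suc r) (Suc s) - a r (Suc s)))"
proof -
  define A where "A = mat (Suc n) (Suc n) (\<lambda>(r, s). a r s)"
  define L where "L = mat (Suc n) (Suc n)
    (\<lambda>(r, k). if k = r then 1 else if Suc k = r then -1 else (0 :: 'a))"
  define D where "D = mat (Suc n) (Suc n) (\<lambda>(r, s). if r = 0 then a 0 s else a r s - a (r - 1) s)"
  have A: "A \<in> carrier_mat (Suc n) (Suc n)" and L: "L \<in> carrier_mat (Suc n) (Suc n)"
    and D: "D \<in> carrier_mat (Suc n) (Suc n)"
    by (simp_all add: A_def L_def D_def)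
  have "det L = prod_list (diag_mat L)"
    by (rule det_lower_triangular[OF _ L]) (simp add: L_def)
  also have "diag_mat L = replicate (Suc n) 1"
    by (rule nth_equalityI) (auto simp: diag_mat_def L_def simp del: upt_Suc replicate_Suc)
  finally have det_L: "det L = 1"
    by (simp del: replicate_Suc)
  have "L * A = D"
  proof (rule eq_matI)
    fix r s assume "r < dim_row D" "s < dim_col D"
    then have r: "r < Suc n" and s: "s < Suc n"
      by (simp_all add: D_def)
    have "(L * A) $$ (r, s) = (\<Sum>k = 0..<Suc n. L $$ (r, k) * a k s)"
      using r s by (simp add: A_def L_def scalar_prod_def)
    \<comment> \<open>For \<open>r = 0\<close> no \<open>k\<close> satisfies
      \<open>Suc k = r\<close>, so nothing is subtracted from the first row.\<close>
    also have "\<dots> = (\<Sum>k = 0..<Suc n. (if k = r then a k s else 0) - (if Suc k = r then a k s else 0))"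
      using r by (intro sum.cong) (auto simp: L_def)
    also have "\<dots> = (\<Sum>k = 0..<Suc n. if k = r then a k s else 0)
        - (\<Sum>k = 0..<Suc n. if Suc k = r then a k s else 0)"
      by (rule sum_subtractf)
    also have "(\<Sum>k = 0..<Suc n. if Suc k = r then a k s else 0) = (if r = 0 then 0 else a (r - 1) s)"
    proof (cases r)
      case (Suc r')
      then show ?thesis
        using r by (simp del: sum.op_ivl_Suc)
    qed simp
    also have "(\<Sum>k = 0..<Suc n. if k = r then a k s else 0) = a r s"
      using r by (simp del: sum.op_ivl_Suc)
    finally show "(L * A) $$ (r, s) = D $$ (r, s)"
      using r s by (simp add: D_def)
  qed (use A L D in auto)
  then have "det A = det D"
    using det_mult[OF L A] det_L by simp
  also have "\<dots> = (\<Sum>i<Suc n. D $$ (i, 0) * cofactor D i 0)"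
    by (rule laplace_expansion_column[OF D]) simp
  also have "\<dots> = D $$ (0, 0) * cofactor D 0 0"
    by (subst sum.lessThan_Suc_shift) (simp add: D_def one)
  also have "\<dots> = det (mat_delete D 0 0)"
    by (simp add: D_def cofactor_def one)
  also have "mat_delete D 0 0 = mat n n (\<lambda>(r, s). a (Suc r) (Suc s) - a r (Suc s))"
    by (rule eq_matI) (auto simp: mat_delete_def D_def)
  finally show ?thesis
    by (simp add: A_def)
qed

lemma det_mat_leibniz:
  "det (mat n n (\<lambda>(r, s). a r s)) =
   (\<Sum>p | p permutes {0..<n}. signof p * (\<Prod>r = 0..<n. a r (p r)))"
proof -
  have "(\<Prod>r = 0..<n. mat n n (\<lambda>(r, s). a r s) $$ (r, p r)) = (\<Prod>r = 0..<n. a r (p r))"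
    if "p permutes {0..<n}" for p
    using permutes_in_image[OF that] by (intro prod.cong) auto
  then show ?thesis
    by (simp add: det_def'[where n = n])
qed

text \<open>Each Leibniz term has exactly one factor from row \<open>k\<close>, so it is additive in
  that row.\<close>

lemma det_add_in_row:
  fixes a b c :: "nat \<Rightarrow> nat \<Rightarrow> 'a :: comm_ring_1"
  assumes k: "k < n"
    and add: "\<And>s. s < n \<Longrightarrow> c k s = a k s + b k s"
    and a: "\<And>r s. r < n \<Longrightarrow> s < n \<Longrightarrow> r \<noteq> k \<Longrightarrow> a r s = c r s"
    and b: "\<And>r s. r < n \<Longrightarrow> s < n \<Longrightarrow> r \<noteq> k \<Longrightarrow> b r s = c r s"
  shows "det (mat n n (\<lambda>(r, s). c r s)) =
         det (mat n n (\<lambda>(r, s). a r s)) + det (mat n n (\<lambda>(r, s). b r s))"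
proof -
  have "(\<Prod>r = 0..<n. c r (p r)) = (\<Prod>r = 0..<n. a r (p r)) + (\<Prod>r = 0..<n. b r (p r))"
    if "p permutes {0..<n}" for p
  proof -
    have p: "p r < n" if "r < n" for r
      using permutes_in_image[OF \<open>p permutes {0..<n}\<close>, of r] that by simp
    have "(\<Prod>r\<in>{0..<n} - {k}. a r (p r)) = (\<Prod>r\<in>{0..<n} - {k}. c r (p r))"
      "(\<Prod>r\<in>{0..<n} - {k}. b r (p r)) = (\<Prod>r\<in>{0..<n} - {k}. c r (p r))"
      using p by (auto intro!: prod.cong a b)
    then show ?thesis
      using k p by (simp add: prod.remove[of "{0..<n}" k] add distrib_right)
  qed
  then show ?thesis
    by (simp add: det_mat_leibniz sum.distrib[symmetric] distrib_left)
qed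

text \<open>Every permutation meets each row and each column exactly once, so all Leibniz terms
  share the same scaling factor.\<close>

lemma det_scale_rows_cols:
  fixes a :: "nat \<Rightarrow> nat \<Rightarrow> 'a :: comm_ring_1"
  shows "det (mat n n (\<lambda>(r, s). x r * y s * a r s)) =
         (\<Prod>r<n. x r) * (\<Prod>s<n. y s) * det (mat n n (\<lambda>(r, s). a r s))"
proof -
  have "(\<Prod>r = 0..<n. x r * y (p r) * a r (p r)) =
      (\<Prod>r<n. x r) * (\<Prod>s<n. y s) * (\<Prod>r = 0..<n. a r (p r))"
    if "p permutes {0..<n}" for p
    using prod.permute[OF that, of y] by (simp add: prod.distrib atLeast0LessThan o_def)
  then show ?thesis
    by (simp add: det_mat_leibniz sum_distrib_left mult.left_commute)
qed

text \<open>Deleting row \<open>t\<close> leaves a gap of two between its neighbours, and the corresponding row of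
  differences is the sum of two consecutive rows of \<open>h\<close>.\<close>

lemma det_skip_row_pascal:
  fixes g h :: "nat \<Rightarrow> nat \<Rightarrow> 'a :: comm_ring_1"
  assumes one: "\<And>x. g x 0 = 1"
    and diff: "\<And>x s. g (Suc x) (Suc s) - g x (Suc s) = h x s"
    and t: "t \<le> Suc n"
  shows "det (mat (Suc n) (Suc n) (\<lambda>(r, s). g (insert_index t r) s)) =
    (if t \<le> n then det (mat n n (\<lambda>(r, s). h (insert_index t r) s)) else 0) +
    (if 1 \<le> t then det (mat n n (\<lambda>(r, s). h (insert_index (t - 1) r) s)) else 0)"
proof -
  define c where
    "c r s = g (insert_index t (Suc r)) (Suc s) - g (insert_index t r) (Suc s)" for r s
  have "det (mat (Suc n) (Suc n) (\<lambda>(r, s). g (insert_index t r) s)) =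
      det (mat n n (\<lambda>(r, s). c r s))"
    by (simp add: det_row_differences one c_def)
  also have "\<dots> = (if t \<le> n then det (mat n n (\<lambda>(r, s). h (insert_index t r) s)) else 0) +
    (if 1 \<le> t then det (mat n n (\<lambda>(r, s). h (insert_index (t - 1) r) s)) else 0)"
  proof -
    \<comment> \<open>Deleting an end row leaves consecutive rows, so one summand survives; only an
      interior \<open>t\<close> creates a gap.\<close>
    consider "t = 0" | "t = Suc n" | "1 \<le> t" "t \<le> n"
      using t by linarith
    then show ?thesis
    proof cases
      case 1
      then show ?thesis
        by (simp add: c_def diff)
    next
      case 2
      then have "mat n n (\<lambda>(r, s). c r s) = mat n n (\<lambda>(r, s). h (insert_index n r) s)"
        by (intro eq_matI) (auto simp: c_def diff)
      with 2 show ?thesis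
        by simp
    next
      case 3
      \<comment> \<open>Rows \<open>t - 1\<close> and \<open>t + 1\<close> become neighbours, and
        their difference telescopes through row \<open>t\<close>.\<close>
      have gap: "c (t - 1) s = h (t - 1) s + h t s" for s
      proof -
        have "Suc (t - 1) = t"
          using 3 by simp
        with diff[of "t - 1" s] 3 show ?thesis
          by (simp add: c_def algebra_simps flip: diff[of t])
      qed
      have "det (mat n n (\<lambda>(r, s). c r s)) = det (mat n n (\<lambda>(r, s). h (insert_index t r) s)) +
          det (mat n n (\<lambda>(r, s). h (insert_index (t - 1) r) s))"
      \<comment> \<open>The maps \<open>insert_index t\<close> and
        \<open>insert_index (t - 1)\<close> differ only at \<open>t - 1\<close>, where they give
        \<open>t - 1\<close> and \<open>t\<close>.\<close>
      proof (rule det_add_in_row[of "t - 1"])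
        show "c (t - 1) s = h (insert_index t (t - 1)) s + h (insert_index (t - 1) (t - 1)) s" for s
          unfolding gap using 3 by simp
        show "h (insert_index t r) s = c r s" if "r \<noteq> t - 1" for r s
          using that 3 by (auto simp: c_def insert_index_def diff)
        show "h (insert_index (t - 1) r) s = c r s" if "r \<noteq> t - 1" for r s
          using that 3 by (auto simp: c_def insert_index_def diff)
      qed (use 3 in auto)
      with 3 show ?thesis
        by simp
    qed
  qed
  finally show ?thesis .
qed

section \<open>Evaluation of the binomial determinants\<close>

text \<open>Differencing the columns [0, n] gives binomials of the same kind in columns [0, n - 1],
  so the splitting becomes Pascal's recursion in \<open>n\<close> and \<open>t\<close>, and the
  offset \<open>a\<close> drops out.\<close>

lemma det_consecutive_binomials:
  assumes "t \<le> n"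
  shows "det (mat n n (\<lambda>(r, s). of_nat ((a + insert_index t r) choose s))) =
         (of_nat (n choose t) :: 'a :: comm_ring_1)"
  using assms
proof (induction n arbitrary: t)
  case 0
  then show ?case
    by simp
next
  case (Suc n)
  let ?b = "\<lambda>x s. of_nat ((a + x) choose s) :: 'a"
  have "det (mat (Suc n) (Suc n) (\<lambda>(r, s). ?b (insert_index t r) s)) =
    (if t \<le> n then det (mat n n (\<lambda>(r, s). ?b (insert_index t r) s)) else 0) +
    (if 1 \<le> t then det (mat n n (\<lambda>(r, s). ?b (insert_index (t - 1) r) s)) else 0)"
    by (rule det_skip_row_pascal) (use Suc.prems in auto)
  also have "\<dots> = (if t \<le> n then of_nat (n choose t) else 0) +
    (if 1 \<le> t then of_nat (n choose (t - 1)) else 0)"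
    by (intro arg_cong2[of _ _ _ _ "(+)"] if_cong refl Suc.IH) (use Suc.prems in auto)
  also have "\<dots> = of_nat (Suc n choose t)"
    \<comment> \<open>At \<open>t = Suc n\<close> the guarded summand is 0, in agreement with
      \<open>n choose Suc n = 0\<close>.\<close>
    using Suc.prems by (cases t) (auto simp: binomial_eq_0)
  finally show ?case .
qed

text \<open>The last denominator is the row factor of the deleted row, divided out of the product
  over all \<open>n + 1\<close> rows. The bound \<open>m \<le> i\<close> makes the row factors
  nonzero and the subtraction \<open>i - m\<close> exact.\<close>

lemma det_shifted_binomials:
  fixes i m n t :: nat
  assumes m: "m \<le> i" and t: "t \<le> n"
  shows "det (mat n n (\<lambda>(r, s). of_nat ((i + insert_index t r) choose (m + s)))) =
    ((\<Prod>k\<le>n. of_nat ((i + k) choose m)) / (\<Prod>k<n. of_nat ((m + k) choose m))) *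
    of_nat (n choose t) / (of_nat ((i + t) choose m) :: 'a :: field_char_0)"
proof -
  define x :: "nat \<Rightarrow> 'a" where "x k = of_nat ((i + k) choose m)" for k
  have entry: "of_nat ((i + k) choose (m + s)) =
      x k * inverse (of_nat ((m + s) choose m)) * (of_nat (((i - m) + k) choose s) :: 'a)" for k s
  proof -
    have "((i + k) choose (m + s)) * ((m + s) choose m) = ((i + k) choose m) * ((i - m + k) choose s)"
    proof (cases "m + s \<le> i + k")
      case True
      then show ?thesis
        using choose_mult[of m "m + s" "i + k"] m by simp
    next
      \<comment> \<open>Here \<open>s\<close> also exceeds \<open>i - m + k\<close>, so both sides
        vanish.\<close>
      case False
      then show ?thesis
        using m by (simp add: binomial_eq_0)
    qed
    then have "(of_nat ((i + k) choose (m + s)) * of_nat ((m + s) choose m) :: 'a) =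
        x k * of_nat ((i - m + k) choose s)"
      by (simp add: x_def flip: of_nat_mult)
    moreover have "(of_nat ((m + s) choose m) :: 'a) \<noteq> 0"
      by simp
    ultimately show ?thesis
      by (simp add: field_simps)
  qed
  have "insert_index t ` {..<n} = {..n} - {t}"
  proof
    show "{..n} - {t} \<subseteq> insert_index t ` {..<n}"
    proof
      fix k assume k: "k \<in> {..n} - {t}"
      then have "k = insert_index t (if k < t then k else k - 1)" "(if k < t then k else k - 1) < n"
        using t by (auto simp: insert_index_def)
      then show "k \<in> insert_index t ` {..<n}"
        by blast
    qed
  qed (use t in \<open>auto simp: insert_index_def\<close>)
  moreover have "inj_on (insert_index t) {..<n}"
    by (rule inj_on_inverseI[of _ "delete_index t"]) simp
  ultimately have "(\<Prod>r<n. x (insert_index t r)) = (\<Prod>k\<in>{..n} - {t}. x k)"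
    using prod.reindex[of "insert_index t" "{..<n}" x] by simp
  moreover have "x t \<noteq> 0"
    using m by (simp add: x_def)
  ultimately have rows: "(\<Prod>r<n. x (insert_index t r)) = (\<Prod>k\<le>n. x k) / x t"
    using t prod.remove[of "{..n}" t x] by simp
  have "det (mat n n (\<lambda>(r, s). of_nat ((i + insert_index t r) choose (m + s)))) =
    (\<Prod>r<n. x (insert_index t r)) * (\<Prod>s<n. inverse (of_nat ((m + s) choose m))) *
    det (mat n n (\<lambda>(r, s). of_nat (((i - m) + insert_index t r) choose s)))"
    unfolding entry by (rule det_scale_rows_cols)
  also have "\<dots> = ((\<Prod>k\<le>n. x k) / (\<Prod>k<n. of_nat ((m + k) choose m))) * of_nat (n choose t) / x t"
    by (simp add: det_consecutive_binomials[OF t] rows prod_inversef[unfolded o_def] divide_inverse mult_ac)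
  finally show ?thesis
    by (simp add: x_def)
qed

section \<open>Index sets as row and column lists\<close>

text \<open>A strictly increasing list is determined by its set, and \<open>insert_index t\<close>
  runs increasingly through the positions other than \<open>t\<close>.\<close>

lemma sorted_list_of_interval_minus:
  assumes "t \<le> N"
  shows "sorted_list_of_set ({i..i + N} - {i + t}) = map (\<lambda>r. i + insert_index t r) [0..<N]"
proof -
  have "set (map (\<lambda>r. i + insert_index t r) [0..<N]) = {i..i + N} - {i + t}"
  proof (intro equalityI subsetI)
    fix k assume k: "k \<in> {i..i + N} - {i + t}"
    then have "k = i + insert_index t (if k < i + t then k - i else k - i - 1)"
      "(if k < i + t then k - i else k - i - 1) < N"
      using assms by (auto simp: insert_index_def)
    then show "k \<in> set (map (\<lambda>r. i + insert_index t r) [0..<N])"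
      by auto
  qed (use assms in \<open>auto simp: insert_index_def split: if_splits\<close>)
  moreover have "sorted_wrt (<) (map (\<lambda>r. i + insert_index t r) [0..<N])"
    by (auto simp: sorted_wrt_iff_nth_less insert_index_def)
  ultimately show ?thesis
    using strict_sorted_equal[OF strict_sorted_list_of_set, of _ "{i..i + N} - {i + t}"] by simp
qed

lemma sorted_list_of_insert_0:
  "sorted_list_of_set (insert 0 {Suc m..m + n}) = 0 # [Suc m..<Suc m + n]"
proof (rule strict_sorted_equal)
  show "sorted_wrt (<) (sorted_list_of_set (insert 0 {Suc m..m + n}))"
    by (rule strict_sorted_list_of_set)
  show "sorted_wrt (<) (0 # [Suc m..<Suc m + n])"
    by (simp del: upt_Suc)
  show "set (sorted_list_of_set (insert 0 {Suc m..m + n})) = set (0 # [Suc m..<Suc m + n])"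
    by (subst set_sorted_list_of_set) auto
qed

text \<open>The guards unite both cases of the theorem: an interior \<open>t\<close> gives two
  summands, an end position one.\<close>

lemma binomial_minor_skip_pascal:
  fixes i m n t :: nat
  assumes "m \<le> i" and t: "t \<le> Suc n"
  defines "X \<equiv> (\<Prod>k\<le>n. of_nat ((i + k) choose m)) / (\<Prod>k<n. of_nat ((m + k) choose m))"
  shows "(of_int (binomial_minor ({i..i + Suc n} - {i + t}) (insert 0 {Suc m..m + n})) :: 'a :: field_char_0) =
    (if t \<le> n then X * of_nat (n choose t) / of_nat ((i + t) choose m) else 0) +
    (if 1 \<le> t then X * of_nat (n choose (t - 1)) / of_nat ((i + (t - 1)) choose m) else 0)"
proof -
  \<comment> \<open>The lower indices jump from 0 to \<open>m + 1\<close>. Differencing column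
    \<open>Suc s\<close> gives lower index \<open>m + s\<close>, as in \<open>h\<close>.\<close>
  define g :: "nat \<Rightarrow> nat \<Rightarrow> 'a"
    where "g x s = of_nat ((i + x) choose (if s = 0 then 0 else m + s))" for x s
  define h :: "nat \<Rightarrow> nat \<Rightarrow> 'a" where "h x s = of_nat ((i + x) choose (m + s))" for x s
  have "card ({i..i + Suc n} - {i + t}) = Suc n"
    using t by (subst card_Diff_singleton) auto
  then have "of_int (binomial_minor ({i..i + Suc n} - {i + t}) (insert 0 {Suc m..m + n})) =
     det (mat (Suc n) (Suc n) (\<lambda>(r, s). g (insert_index t r) s))"
    unfolding binomial_minor_def sorted_list_of_insert_0 sorted_list_of_interval_minus[OF t] of_int_hom.hom_det[symmetric]
    by (intro arg_cong[of _ _ det] eq_matI)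
      (auto simp: g_def nth_Cons' simp del: upt_Suc)
  also have "\<dots> = (if t \<le> n then det (mat n n (\<lambda>(r, s). h (insert_index t r) s)) else 0) +
    (if 1 \<le> t then det (mat n n (\<lambda>(r, s). h (insert_index (t - 1) r) s)) else 0)"
    by (rule det_skip_row_pascal[OF _ _ t]) (simp_all add: g_def h_def)
  also have "\<dots> = (if t \<le> n then X * of_nat (n choose t) / of_nat ((i + t) choose m) else 0) +
    (if 1 \<le> t then X * of_nat (n choose (t - 1)) / of_nat ((i + (t - 1)) choose m) else 0)"
    unfolding h_def X_def using t
    by (intro arg_cong2[of _ _ _ _ "(+)"] if_cong refl det_shifted_binomials[OF assms(1)]) auto
  finally show ?thesis .
qed

theorem theorem7p1:
  fixes d i j :: nat and I J :: "nat set" and lam :: rat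
  assumes "d \<ge> 3" and "j \<ge> 1"
    and "I = {i..i + d - 1}"
    and "J = {0} \<union> {j..j + d - 3}"
    and "index_le J (I - {i + d - 1})"
    and "lam = (\<Prod>k=1..d-1. of_nat ((i + k - 1) choose (j - 1))) /
               (\<Prod>k=0..d-3. of_nat ((j + k - 1) choose (j - 1)))"
  shows "(\<forall>r. 2 \<le> r \<and> r \<le> d - 1 \<longrightarrow>
            of_int (binomial_minor (I - {i + r - 1}) J) =
              lam * (of_nat ((d - 2) choose (r - 1)) / of_nat ((i + r - 1) choose (j - 1)) +
                     of_nat ((d - 2) choose (r - 2)) / of_nat ((i + r - 2) choose (j - 1)))) \<and>
         of_int (binomial_minor (I - {i}) J) = lam / of_nat (i choose (j - 1)) \<and>
         of_int (binomial_minor (I - {i + d - 1}) J) = lam / of_nat ((i + d - 2) choose (j - 1))"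
proof -
  define n where "n = d - 2"
  define m where "m = j - 1"
  have d: "d = n + 2" "1 \<le> n" and j: "j = Suc m"
    using assms(1,2) by (simp_all add: n_def m_def)
  have I: "I = {i..i + Suc n}" and J: "J = insert 0 {Suc m..m + n}"
    using d j by (auto simp: assms(3,4))
  have "1 < card J"
    using d by (simp add: J)
  \<comment> \<open>The second smallest elements are \<open>Suc m\<close> and \<open>i + 1\<close>;
    comparing them yields \<open>m \<le> i\<close>.\<close>
  then have "sorted_list_of_set J ! 1 \<le> sorted_list_of_set ({i..i + Suc n} - {i + Suc n}) ! 1"
    using assms(5) d by (auto simp: index_le_def I)
  then have m: "m \<le> i"
    using d unfolding J sorted_list_of_insert_0 sorted_list_of_interval_minus[OF order.refl] by (simp del: upt_Suc)
  have "(\<Prod>k=1..d-1. of_nat ((i + k - 1) choose (j - 1))) = (\<Prod>k\<le>n. of_nat ((i + k) choose m) :: rat)"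
    by (rule prod.reindex_bij_witness[of _ Suc "\<lambda>k. k - 1"]) (auto simp: d j)
  moreover have "{0..d-3} = {..<n}"
    using d by auto
  ultimately have lam: "lam = (\<Prod>k\<le>n. of_nat ((i + k) choose m)) / (\<Prod>k<n. of_nat ((m + k) choose m))"
    by (simp add: assms(6) j)
  note minor = binomial_minor_skip_pascal[where 'a = rat, OF m, of _ n, folded I J lam]
  have "of_int (binomial_minor (I - {i + r - 1}) J) =
      lam * (of_nat ((d - 2) choose (r - 1)) / of_nat ((i + r - 1) choose (j - 1)) +
             of_nat ((d - 2) choose (r - 2)) / of_nat ((i + r - 2) choose (j - 1)))"
    if r: "2 \<le> r" "r \<le> d - 1" for r
  proof -
    \<comment> \<open>The deleted row \<open>i + r - 1\<close> has position
      \<open>r - 1 = Suc u\<close>; this substitution removes the truncated subtractions.\<close>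
    define u where "u = r - 2"
    have u: "r = Suc (Suc u)" "Suc u \<le> n"
      using r d by (simp_all add: u_def)
    show ?thesis
      using minor[of "Suc u"] u d by (simp add: j algebra_simps)
  qed
  \<comment> \<open>At the end positions 0 and \<open>Suc n\<close> the surviving coefficient is
    \<open>n choose 0\<close> or \<open>n choose n\<close>, hence 1.\<close>
  moreover have "of_int (binomial_minor (I - {i}) J) = lam / of_nat (i choose (j - 1))"
    using minor[of 0] by (simp add: j)
  moreover have "of_int (binomial_minor (I - {i + d - 1}) J) = lam / of_nat ((i + d - 2) choose (j - 1))"
    using minor[of "Suc n"] d by (simp add: j)
  ultimately show ?thesis
    by blast
qed

end
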